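(* Assume CH (the Continuum Hypothesis). Then there exists a countable regular topological space $X$ without isolated points which is $mS$-separable but not $S$-separable.
   Context: $\omega$ is the set of natural numbers, each $k\in\omega$ is identified with $\{0,\dots,k-1\}$, and $[D]^{<\omega}$ denotes the set of finite subsets of $D$. A topological space $X$ is $S$-separable if for every sequence $\langle D_n:n\in\omega\rangle$ of dense subsets of $X$ there exists a sequence $\langle F_n:n\in\omega\rangle$ such that $F_n\in[D_n]^{<\omega}$ for all $n\in\omega$, and for every finite family $\{U_i:i\in k\}$ of non-empty open subsets of $X$ there exists $n\in\omega$ with $U_i\cap F_n\neq\emptyset$ for all $i\in k$. $X$ is $mS$-separable if the condition in the definition of $S$-separability holds for all decreasing sequences $\langle D_n:n\in\omega\rangle$ (i.e., $D_{n+1}\subset D_n$ for all $n$) of dense subsets of $X$. *)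

theory Defs
  imports "HOL-Analysis.Analysis"
begin

unbundle cardinal_syntax

(* cardSuc natLeq is aleph_1, so this reads 2^aleph_0 = aleph_1. *)
definition continuum_hypothesis :: bool where
  "continuum_hypothesis \<longleftrightarrow> |UNIV :: nat set set| =o cardSuc natLeq"

unbundle no cardinal_syntax

definition dense_subset_of :: "'a topology \<Rightarrow> 'a set \<Rightarrow> bool" where
  "dense_subset_of X D \<longleftrightarrow> D \<subseteq> topspace X \<and> X closure_of D = topspace X"

(* The selection property shared by S- and mS-separability. A finite family indexed by
   {0,...,k-1} is given by the first k values of U. *)
definition has_S_selection :: "'a topology \<Rightarrow> (nat \<Rightarrow> 'a set) \<Rightarrow> bool" where
  "has_S_selection X D \<longleftrightarrow>
     (\<exists>F :: nat \<Rightarrow> 'a set.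
        (\<forall>n. finite (F n) \<and> F n \<subseteq> D n) \<and>
        (\<forall>(k :: nat) (U :: nat \<Rightarrow> 'a set).
           (\<forall>i<k. openin X (U i) \<and> U i \<noteq> {}) \<longrightarrow>
           (\<exists>n. \<forall>i<k. U i \<inter> F n \<noteq> {})))"

definition S_separable :: "'a topology \<Rightarrow> bool" where
  "S_separable X \<longleftrightarrow>
     (\<forall>D :: nat \<Rightarrow> 'a set. (\<forall>n. dense_subset_of X (D n)) \<longrightarrow> has_S_selection X D)"

definition mS_separable :: "'a topology \<Rightarrow> bool" where
  "mS_separable X \<longleftrightarrow>
     (\<forall>D :: nat \<Rightarrow> 'a set.
        (\<forall>n. dense_subset_of X (D n)) \<and> (\<forall>n. D (Suc n) \<subseteq> D n) \<longrightarrow> has_S_selection X D)"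

definition without_isolated_points :: "'a topology \<Rightarrow> bool" where
  "without_isolated_points X \<longleftrightarrow> (\<forall>x \<in> topspace X. \<not> openin X {x})"

end

theory Submission
  imports Defs
begin

text \<open>
  The points are the natural numbers, split into infinitely many infinite pieces \<open>idx -` {m}\<close>, which
  stay dense throughout; the base of the topology is a Boolean algebra, the union of a chain of
  countable algebras of length \<open>\<omega>\<^sub>1\<close>. Each step adjoins a set \<open>U\<close> obtained from a Cohen generic set.
  Given finite \<open>F m \<subseteq> idx -` {m}\<close>, the generic set is chosen on the quotient that collapses every
  \<open>F m\<close> to a point, so no \<open>F m\<close> meets both \<open>U\<close> and its complement; under CH all such \<open>F\<close> are treated,
  and the pieces witness the failure of S-separability.

  For a decreasing sequence \<open>E\<close> of dense sets, finite \<open>G n \<subseteq> E n\<close> are chosen so that every finite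
  family of basic sets is met by some \<open>G n\<close> in points which are far out in pieces of bounded index or
  lie in pairwise different pieces of large index. This is possible because a decreasing sequence
  either stays infinite in one piece or meets infinitely many. Points of this kind are eventually
  not identified by any of the collapsing maps, so a generic set splits them arbitrarily, and the
  property of \<open>G\<close> survives all further steps.
\<close>

subsection \<open>Diagonalisation under the continuum hypothesis\<close>


unbundle cardinal_syntax

text \<open>Proper initial segments of a cardinal order have smaller cardinality, here below aleph_1
  and hence countable. The sets of naturals thus index a chain of length omega_1, and they also
  serve as codes of the tasks.\<close>

lemma continuum_hypothesis_wellorder:
  assumes continuum_hypothesis
  obtains R :: "nat set rel"
  where "wf R" "\<And>s t. s \<noteq> t \<Longrightarrow> (s, t) \<in> R \<or> (t, s) \<in> R" "\<And>t. countable {s. (s, t) \<in> R}"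
proof -
  let ?r = "|UNIV :: nat set set|"
  have wo: "Well_order ?r" by (rule card_of_Well_order)
  have lin: "linear_order_on (Field ?r) ?r" "wf (?r - Id)"
    using wo unfolding well_order_on_def by auto
  have "countable {s. (s, t) \<in> ?r - Id}" for t
  proof -
    have "|underS ?r t| <o ?r"
      by (rule card_of_underS[OF card_of_Card_order]) (simp add: Field_card_of)
    also have "?r =o cardSuc natLeq"
      using assms unfolding continuum_hypothesis_def .
    finally have "|underS ?r t| \<le>o natLeq"
      using cardSuc_ordLeq_ordLess[OF natLeq_Card_order card_of_Card_order] by blast
    then have "|underS ?r t| \<le>o |UNIV :: nat set|"
      using card_of_nat ordIso_symmetric ordLeq_ordIso_trans by blast
    then have "countable (underS ?r t)"
      unfolding card_of_ordLeq[symmetric] countable_def by auto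
    moreover have "{s. (s, t) \<in> ?r - Id} = underS ?r t"
      unfolding underS_def by auto
    ultimately show ?thesis by simp
  qed
  moreover have "(s, t) \<in> ?r - Id \<or> (t, s) \<in> ?r - Id" if "s \<noteq> t" for s t
    using lin(1) that unfolding order_on_defs total_on_def by (auto simp: Field_card_of)
  ultimately show thesis using lin(2) that by blast
qed

unbundle no cardinal_syntax

text \<open>Stage \<open>t\<close> is chosen above the supremum of all earlier stages and meets task
  \<open>t\<close>. Every stage has only countably many predecessors, so the invariant
  \<open>N\<close> has to survive suprema of countable chains only.\<close>

lemma continuum_hypothesis_chain:
  fixes N :: "'s::complete_lattice \<Rightarrow> bool" and T :: "nat set \<Rightarrow> 's \<Rightarrow> bool"
  assumes CH: continuum_hypothesis
    and base: "N s0"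
    and Sup: "\<And>C. countable C \<Longrightarrow> C \<noteq> {} \<Longrightarrow> \<forall>s\<in>C. N s \<Longrightarrow> \<forall>s\<in>C. \<forall>t\<in>C. s \<le> t \<or> t \<le> s \<Longrightarrow> N (Sup C)"
    and step: "\<And>t s. N s \<Longrightarrow> \<exists>s'\<ge>s. N s' \<and> T t s'"
  obtains f where "\<And>t. N (f t)" "\<And>t. T t (f t)" "\<And>t u. f t \<le> f u \<or> f u \<le> f t"
proof -
  obtain R :: "nat set rel" where R: "wf R"
      "\<And>s t. s \<noteq> t \<Longrightarrow> (s, t) \<in> R \<or> (t, s) \<in> R" "\<And>t. countable {s. (s, t) \<in> R}"
    using continuum_hypothesis_wellorder[OF CH] by blast
  \<comment> \<open>Inserting \<open>s0\<close> keeps the family nonempty at the least index. The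
    premise in \<open>P\<close> makes a choice possible for arbitrary \<open>f\<close>; it is
    discharged by the induction for \<open>main\<close>.\<close>
  define C where "C f t = insert s0 (f ` {s. (s, t) \<in> R})" for f and t :: "nat set"
  define P where "P f t s \<longleftrightarrow> (N (Sup (C f t)) \<longrightarrow> Sup (C f t) \<le> s \<and> N s \<and> T t s)" for f t s
  have "\<exists>f. \<forall>t. P f t (f t)"
  proof (rule dependent_wf_choice[OF R(1)])
    show "P f t s = P g t s" if "\<And>z. (z, t) \<in> R \<Longrightarrow> f z = g z" for f g t s
    proof -
      have "C f t = C g t" using that unfolding C_def by auto
      then show ?thesis unfolding P_def by simp
    qed
    show "\<exists>s. P f t s" for f t
      using step unfolding P_def by blast
  qed
  then obtain f where f: "\<And>t. P f t (f t)" by blast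
  have main: "N (f t) \<and> T t (f t) \<and> s0 \<le> f t \<and> (\<forall>u. (u, t) \<in> R \<longrightarrow> f u \<le> f t)" for t
  proof (induction t rule: wf_induct_rule[OF R(1)])
    case (1 t)
    have "\<forall>s\<in>C f t. \<forall>u\<in>C f t. s \<le> u \<or> u \<le> s"
      unfolding C_def using 1 R(2) by auto (metis order_refl)
    then have "N (Sup (C f t))"
      using base 1 R(3) by (intro Sup) (auto simp: C_def)
    then have s: "Sup (C f t) \<le> f t" "N (f t)" "T t (f t)"
      using f[of t] unfolding P_def by auto
    have "s \<le> f t" if "s \<in> C f t" for s
      using s(1) that Sup_upper order_trans by blast
    then show ?case using s unfolding C_def by blast
  qed
  have "f t \<le> f u \<or> f u \<le> f t" for t u
    using main R(2) by (metis order_refl)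
  with main that show thesis by blast
qed

text \<open>Rasiowa--Sikorski for Cohen forcing: a condition \<open>(P, N)\<close> decides that the generic set
  contains \<open>P\<close> and misses \<open>N\<close>.\<close>

lemma generic_set:
  fixes \<R> :: "(nat set \<Rightarrow> bool) set" and P0 N0 :: "nat set"
  assumes "countable \<R>" "finite P0" "finite N0" "P0 \<inter> N0 = {}"
    and dense: "\<And>r P N. r \<in> \<R> \<Longrightarrow> finite P \<Longrightarrow> finite N \<Longrightarrow> P \<inter> N = {} \<Longrightarrow>
        \<exists>P' N'. finite P' \<and> finite N' \<and> P' \<inter> N' = {} \<and> P \<subseteq> P' \<and> N \<subseteq> N' \<and>
          (\<forall>V. P' \<subseteq> V \<and> V \<inter> N' = {} \<longrightarrow> r V)"
  shows "\<exists>V. P0 \<subseteq> V \<and> V \<inter> N0 = {} \<and> (\<forall>r\<in>\<R>. r V)"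
proof (cases "\<R> = {}")
  case True
  show ?thesis by (rule exI[of _ P0]) (use assms True in auto)
next
  case False
  define e where "e = from_nat_into \<R>"
  have e: "range e = \<R>"
    unfolding e_def by (rule range_from_nat_into[OF False assms(1)])
  define cond where "cond p \<longleftrightarrow> finite (fst p) \<and> finite (snd p) \<and> fst p \<inter> snd p = {} \<and> P0 \<subseteq> fst p \<and> N0 \<subseteq> snd p"
    for p :: "nat set \<times> nat set"
  define ext where "ext n p p' \<longleftrightarrow> fst p \<subseteq> fst p' \<and> snd p \<subseteq> snd p' \<and>
      (\<forall>V. fst p' \<subseteq> V \<and> V \<inter> snd p' = {} \<longrightarrow> e n V)" for n and p p' :: "nat set \<times> nat set"
  have "\<exists>p'. cond p' \<and> ext n p p'" if p: "cond p" for p n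
  proof -
    obtain P' N' where "finite P'" "finite N'" "P' \<inter> N' = {}" "fst p \<subseteq> P'" "snd p \<subseteq> N'"
        "\<forall>V. P' \<subseteq> V \<and> V \<inter> N' = {} \<longrightarrow> e n V"
      using dense[of "e n" "fst p" "snd p"] p e unfolding cond_def by blast
    then show ?thesis
      using p unfolding cond_def ext_def by (intro exI[of _ "(P', N')"]) auto
  qed
  moreover have "\<exists>p. cond p"
    using assms unfolding cond_def by (intro exI[of _ "(P0, N0)"]) auto
  ultimately obtain p where p: "\<And>n. cond (p n)" "\<And>n. ext n (p n) (p (Suc n))"
    using dependent_nat_choice[of "\<lambda>_. cond" ext] by blast
  have mono: "fst (p m) \<subseteq> fst (p n)" "snd (p m) \<subseteq> snd (p n)" if "m \<le> n" for m n
  proof -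
    have "fst (p n) \<subseteq> fst (p (Suc n))" "snd (p n) \<subseteq> snd (p (Suc n))" for n
      using p(2)[of n] unfolding ext_def by auto
    then show "fst (p m) \<subseteq> fst (p n)" "snd (p m) \<subseteq> snd (p n)"
      using lift_Suc_mono_le[of "\<lambda>n. fst (p n)", OF _ that]
        lift_Suc_mono_le[of "\<lambda>n. snd (p n)", OF _ that] by auto
  qed
  define V where "V = (\<Union>n. fst (p n))"
  have disj: "V \<inter> snd (p n) = {}" for n
  proof -
    have "fst (p m) \<inter> snd (p n) = {}" for m
    proof -
      have "fst (p m) \<subseteq> fst (p (max m n))" "snd (p n) \<subseteq> snd (p (max m n))"
        by (rule mono, simp)+
      then show ?thesis using p(1)[of "max m n"] unfolding cond_def by blast
    qed
    then show ?thesis unfolding V_def by blast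
  qed
  show ?thesis
  proof (intro exI[of _ V] conjI ballI)
    show "P0 \<subseteq> V" "V \<inter> N0 = {}"
      using p(1)[of 0] disj[of 0] unfolding V_def cond_def by auto
    fix r assume "r \<in> \<R>"
    then obtain n where n: "r = e n" using e by blast
    have "fst (p (Suc n)) \<subseteq> V" unfolding V_def by auto
    then show "r V" using p(2)[of n] disj[of "Suc n"] unfolding n ext_def by blast
  qed
qed

subsection \<open>Generic extensions of countable algebras\<close>


definition idx :: "nat \<Rightarrow> nat" where
  "idx x = fst (prod_decode x)"

text \<open>Far away from a given finite set of points, a spaced tuple is injective modulo every
  collapsing map: the points of index at most \<open>c\<close> avoid the finitely many relevant sets \<open>F m\<close>, the
  other ones lie in different pieces.\<close>

definition spaced :: "nat \<Rightarrow> nat \<Rightarrow> nat \<Rightarrow> (nat \<Rightarrow> nat) \<Rightarrow> bool" where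
  "spaced c h k x \<longleftrightarrow> inj_on x {..<k} \<and>
     (\<forall>i<k. idx (x i) \<le> c \<and> h \<le> x i \<or> h \<le> idx (x i) \<and> (\<forall>j<k. j \<noteq> i \<longrightarrow> idx (x j) \<noteq> idx (x i)))"

text \<open>This is the form of the selection property that passes to generic extensions. The bound
  \<open>c\<close> depends on \<open>L\<close> alone, so that \<open>h\<close> can afterwards be
  taken beyond all points of index at most \<open>c\<close> that a collapsing map identifies with
  other points.\<close>

definition robust :: "nat set set \<Rightarrow> (nat \<Rightarrow> nat set) \<Rightarrow> bool" where
  "robust \<A> G \<longleftrightarrow> (\<forall>L\<in>lists (\<A> - {{}}). \<exists>c. \<forall>h. \<exists>n x. spaced c h (length L) x \<and>
     (\<forall>i<length L. x i \<in> L ! i \<inter> G n))"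

text \<open>Infinitely many points are demanded so that some remain undecided by any finite
  condition.\<close>

definition spread :: "nat set set \<Rightarrow> bool" where
  "spread \<A> \<longleftrightarrow> (\<forall>A\<in>\<A> - {{}}. \<forall>m. infinite (A \<inter> idx -` {m}))"

text \<open>A stage is a pair of an algebra and a set of selections that have to be respected by all later
  stages.\<close>

definition admissible :: "nat set set \<times> (nat \<Rightarrow> nat set) set \<Rightarrow> bool" where
  "admissible s \<longleftrightarrow> countable (fst s) \<and> countable (snd s) \<and> algebra UNIV (fst s) \<and> spread (fst s) \<and>
     (\<forall>G\<in>snd s. robust (fst s) G)"

text \<open>If \<open>\<A>\<close> is an algebra, this is the algebra generated by
  \<open>\<A>\<close> and \<open>U\<close>.\<close>

definition adjoin :: "nat set \<Rightarrow> nat set set \<Rightarrow> nat set set" where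
  "adjoin U \<A> = (\<lambda>(A, B). (A \<inter> U) \<union> (B - U)) ` (\<A> \<times> \<A>)"

lemma infinite_idx: "infinite (idx -` {m})"
proof -
  have "range (\<lambda>i. prod_encode (m, i)) \<subseteq> idx -` {m}"
    by (auto simp: idx_def)
  moreover have "infinite (range (\<lambda>i. prod_encode (m, i)))"
    by (rule range_inj_infinite) (auto simp: inj_on_def)
  ultimately show ?thesis using finite_subset by blast
qed

lemma spaced_mono:
  assumes "spaced c h' k x" "h \<le> h'"
  shows "spaced c h k x"
  using assms unfolding spaced_def by (meson order_trans)

lemma algebra_adjoin:
  assumes "algebra UNIV \<A>"
  shows "algebra UNIV (adjoin U \<A>)" "\<A> \<subseteq> adjoin U \<A>" "U \<in> adjoin U \<A>"
proof -
  interpret algebra UNIV \<A> by fact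
  have mem: "(A \<inter> U) \<union> (B - U) \<in> adjoin U \<A>" if "A \<in> \<A>" "B \<in> \<A>" for A B
    using that unfolding adjoin_def by force
  show "\<A> \<subseteq> adjoin U \<A>"
  proof
    fix A assume "A \<in> \<A>"
    then show "A \<in> adjoin U \<A>" using mem[of A A] by (simp add: Un_Diff_Int Un_commute)
  qed
  show "U \<in> adjoin U \<A>" using mem[of UNIV "{}"] by simp
  show "algebra UNIV (adjoin U \<A>)"
    unfolding algebra_iff_Int
  proof (intro conjI ballI)
    show "{} \<in> adjoin U \<A>" using mem[of "{}" "{}"] by simp
    fix S assume "S \<in> adjoin U \<A>"
    then obtain A B where S: "S = (A \<inter> U) \<union> (B - U)" "A \<in> \<A>" "B \<in> \<A>"
      unfolding adjoin_def by auto
    have "UNIV - S = ((UNIV - A) \<inter> U) \<union> ((UNIV - B) - U)" using S by auto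
    then show "UNIV - S \<in> adjoin U \<A>" using mem[of "UNIV - A" "UNIV - B"] S by (metis compl_sets)
    fix T assume "T \<in> adjoin U \<A>"
    then obtain C D where T: "T = (C \<inter> U) \<union> (D - U)" "C \<in> \<A>" "D \<in> \<A>"
      unfolding adjoin_def by auto
    have "S \<inter> T = ((A \<inter> C) \<inter> U) \<union> ((B \<inter> D) - U)" using S T by auto
    then show "S \<inter> T \<in> adjoin U \<A>" using mem[of "A \<inter> C" "B \<inter> D"] S T by (metis Int)
  qed auto
qed

text \<open>A nonempty member of the new algebra contains all points of some nonempty old member
  \<open>A\<close> that lie on a prescribed side of \<open>U\<close>. Hence \<open>spread\<close>
  and \<open>robust\<close> for the new algebra reduce to old members with prescribed sides, which
  is what \<open>pts\<close> and \<open>fam\<close> provide.\<close>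

lemma admissible_adjoin:
  assumes adm: "admissible (\<A>, \<P>)"
    and pts: "\<And>A m h b. A \<in> \<A> - {{}} \<Longrightarrow> \<exists>x\<in>A. idx x = m \<and> h \<le> x \<and> (x \<in> U \<longleftrightarrow> b)"
    and fam: "\<And>G L c h. G \<in> \<P> \<Longrightarrow> L \<in> lists ((\<A> - {{}}) \<times> UNIV) \<Longrightarrow>
        (\<And>h. \<exists>n x. spaced c h (length L) x \<and> (\<forall>i<length L. x i \<in> fst (L ! i) \<inter> G n)) \<Longrightarrow>
        \<exists>n x. spaced c h (length L) x \<and> (\<forall>i<length L. x i \<in> fst (L ! i) \<inter> G n \<and> (x i \<in> U \<longleftrightarrow> snd (L ! i)))"
  shows "admissible (adjoin U \<A>, \<P>)"
proof -
  have adm': "countable \<A>" "countable \<P>" "algebra UNIV \<A>" "\<And>G. G \<in> \<P> \<Longrightarrow> robust \<A> G"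
    using adm unfolding admissible_def by auto
  have half: "\<exists>A b. A \<in> \<A> - {{}} \<and> (\<forall>x\<in>A. (x \<in> U \<longleftrightarrow> b) \<longrightarrow> x \<in> S)" if S0: "S \<in> adjoin U \<A> - {{}}" for S
  proof -
    obtain A B where S: "S = (A \<inter> U) \<union> (B - U)" "A \<in> \<A>" "B \<in> \<A>"
      using S0 unfolding adjoin_def by auto
    have "S \<noteq> {}" using S0 by simp
    show ?thesis
    proof (cases "A \<inter> U = {}")
      case True
      then show ?thesis using S \<open>S \<noteq> {}\<close> by (intro exI[of _ B] exI[of _ False]) auto
    next
      case False
      then show ?thesis using S by (intro exI[of _ A] exI[of _ True]) auto
    qed
  qed
  then obtain a b where ab: "\<And>S. S \<in> adjoin U \<A> - {{}} \<Longrightarrow> a S \<in> \<A> - {{}}"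
      "\<And>S x. S \<in> adjoin U \<A> - {{}} \<Longrightarrow> x \<in> a S \<Longrightarrow> (x \<in> U \<longleftrightarrow> b S) \<Longrightarrow> x \<in> S"
    by metis
  have "spread (adjoin U \<A>)"
    unfolding spread_def
  proof (intro ballI allI)
    fix S m assume S: "S \<in> adjoin U \<A> - {{}}"
    have "\<exists>x\<ge>h. x \<in> S \<inter> idx -` {m}" for h
      using pts[OF ab(1)[OF S], of m h "b S"] ab(2)[OF S] by blast
    then show "infinite (S \<inter> idx -` {m})"
      unfolding infinite_nat_iff_unbounded_le by blast
  qed
  moreover have "robust (adjoin U \<A>) G" if G: "G \<in> \<P>" for G
    unfolding robust_def
  proof
    fix L assume L: "L \<in> lists (adjoin U \<A> - {{}})"
    have Li: "L ! i \<in> adjoin U \<A> - {{}}" if "i < length L" for i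
      using L that by (metis in_listsD nth_mem)
    have aL: "\<forall>S\<in>set L. a S \<in> \<A> - {{}}"
      using L ab(1) unfolding in_lists_conv_set by blast
    then have "map a L \<in> lists (\<A> - {{}})"
      unfolding in_lists_conv_set set_map by blast
    then have "\<exists>c. \<forall>h. \<exists>n x. spaced c h (length (map a L)) x \<and> (\<forall>i<length (map a L). x i \<in> map a L ! i \<inter> G n)"
      using adm'(4)[OF G] unfolding robust_def by blast
    then obtain c where c: "\<And>h. \<exists>n x. spaced c h (length L) x \<and> (\<forall>i<length L. x i \<in> a (L ! i) \<inter> G n)"
      by auto
    \<comment> \<open>Each new set is replaced by an old one together with a side of
      \<open>U\<close>; the bound \<open>c\<close> of the old sets is kept.\<close>
    let ?L = "map (\<lambda>S. (a S, b S)) L"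
    have L': "?L \<in> lists ((\<A> - {{}}) \<times> UNIV)"
      using aL unfolding in_lists_conv_set set_map by blast
    have "\<exists>n x. spaced c h (length L) x \<and> (\<forall>i<length L. x i \<in> L ! i \<inter> G n)" for h
    proof -
      obtain n x where x: "spaced c h (length L) x"
          "\<And>i. i < length L \<Longrightarrow> x i \<in> a (L ! i) \<inter> G n \<and> (x i \<in> U \<longleftrightarrow> b (L ! i))"
        using fam[OF G L', of c h] c by auto
      then show ?thesis using ab(2)[OF Li] by blast
    qed
    then show "\<exists>c. \<forall>h. \<exists>n x. spaced c h (length L) x \<and> (\<forall>i<length L. x i \<in> L ! i \<inter> G n)" by blast
  qed
  moreover have "countable (adjoin U \<A>)"
    using adm' unfolding adjoin_def by auto
  ultimately show ?thesis
    using adm' algebra_adjoin(1)[OF adm'(3)] unfolding admissible_def by auto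
qed

text \<open>The map \<open>q\<close> collapses sets \<open>F m \<subseteq> idx -` {m}\<close> to points.\<close>

lemma admissible_extend:
  fixes q :: "nat \<Rightarrow> nat"
  assumes adm: "admissible (\<A>, \<P>)"
    and fib: "\<And>z. finite (q -` {z})"
    and q_idx: "\<And>x y. q x = q y \<Longrightarrow> idx x = idx y"
    and q_inj: "\<And>m. finite {x. idx x = m \<and> (\<exists>y. y \<noteq> x \<and> q y = q x)}"
    and fin: "finite P0" "finite N0" "P0 \<inter> N0 = {}"
  obtains V where "P0 \<subseteq> V" "V \<inter> N0 = {}" "admissible (adjoin (q -` V) \<A>, \<P>)"
proof -
  have adm': "countable \<A>" "countable \<P>" "spread \<A>"
    using adm unfolding admissible_def by auto
  have fibs: "finite (q -` Z)" if "finite Z" for Z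
  proof -
    have "q -` Z = (\<Union>z\<in>Z. q -` {z})" by auto
    then show ?thesis using fib that by auto
  qed
  \<comment> \<open>\<open>pt\<close> and \<open>fm\<close> express \<open>pts\<close> and
    \<open>fam\<close> of the previous lemma as requirements on \<open>V\<close>. There are only
    countably many, so one generic set meets them all.\<close>
  define pt where "pt = (\<lambda>(A, m, h, b) V. \<exists>x\<in>A. idx x = m \<and> h \<le> x \<and> (x \<in> q -` V \<longleftrightarrow> b))"
  define fm where "fm = (\<lambda>(G :: nat \<Rightarrow> nat set, L :: (nat set \<times> bool) list, c, h) V.
      \<exists>n x. spaced c h (length L) x \<and>
        (\<forall>i<length L. x i \<in> fst (L ! i) \<inter> G n \<and> (x i \<in> q -` V \<longleftrightarrow> snd (L ! i))))"
  define F where "F = {(G, L, c, h :: nat). G \<in> \<P> \<and> L \<in> lists ((\<A> - {{}}) \<times> (UNIV :: bool set)) \<and>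
      (\<forall>h. \<exists>n x. spaced c h (length L) x \<and> (\<forall>i<length L. x i \<in> fst (L ! i) \<inter> G n))}"
  define Q where "Q = (\<A> - {{}}) \<times> (UNIV :: nat set) \<times> (UNIV :: nat set) \<times> (UNIV :: bool set)"
  define R where "R = pt ` Q \<union> fm ` F"
  have "countable F"
    by (rule countable_subset[of _ "\<P> \<times> lists ((\<A> - {{}}) \<times> (UNIV :: bool set)) \<times> UNIV \<times> UNIV"])
      (use adm' in \<open>auto simp: F_def\<close>)
  moreover have "countable Q" using adm' unfolding Q_def by auto
  ultimately have count: "countable R" unfolding R_def by blast
  have dense_pt: "\<exists>P' N'. finite P' \<and> finite N' \<and> P' \<inter> N' = {} \<and> P \<subseteq> P' \<and> N \<subseteq> N' \<and>
          (\<forall>V. P' \<subseteq> V \<and> V \<inter> N' = {} \<longrightarrow> pt (A, m, h, b) V)"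
    if "A \<in> \<A> - {{}}" "finite P" "finite N" "P \<inter> N = {}" for A m h b P N
  proof -
    \<comment> \<open>Finite fibres leave only finitely many points of the piece that are decided by
      the condition or lie below \<open>h\<close>.\<close>
    have "infinite (A \<inter> idx -` {m})" using adm'(3) that(1) unfolding spread_def by blast
    moreover have "finite ({..<h} \<union> q -` (P \<union> N))" using fibs that by auto
    ultimately have "\<not> A \<inter> idx -` {m} \<subseteq> {..<h} \<union> q -` (P \<union> N)" using finite_subset by blast
    then obtain x where "x \<in> A \<inter> idx -` {m}" "x \<notin> {..<h} \<union> q -` (P \<union> N)" by blast
    then have x: "x \<in> A" "idx x = m" "h \<le> x" "q x \<notin> P" "q x \<notin> N" by auto
    show ?thesis
    proof (cases b)
      case True
      then show ?thesis using x that unfolding pt_def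
        by (intro exI[of _ "insert (q x) P"] exI[of _ N]) auto
    next
      case False
      then show ?thesis using x that unfolding pt_def
        by (intro exI[of _ P] exI[of _ "insert (q x) N"]) auto
    qed
  qed
  have dense_fm: "\<exists>P' N'. finite P' \<and> finite N' \<and> P' \<inter> N' = {} \<and> P \<subseteq> P' \<and> N \<subseteq> N' \<and>
          (\<forall>V. P' \<subseteq> V \<and> V \<inter> N' = {} \<longrightarrow> fm (G, L, c, h) V)"
    if GF: "(G, L, c, h) \<in> F" and "finite P" "finite N" "P \<inter> N = {}" for G L c h P N
  proof -
    let ?k = "length L"
    \<comment> \<open>\<open>?W\<close> holds the points already decided, \<open>?D\<close> those of
      index at most \<open>c\<close> that share their fibre. Beyond these finite sets a spaced tuple
      has new and pairwise different images, so its sides can be prescribed freely.\<close>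
    let ?W = "q -` (P \<union> N)"
    let ?D = "\<Union>m\<le>c. {x. idx x = m \<and> (\<exists>y. y \<noteq> x \<and> q y = q x)}"
    have "finite ({h} \<union> ?W \<union> idx ` ?W \<union> ?D)" using fibs that q_inj by auto
    then obtain h' where h': "\<And>x. x \<in> {h} \<union> ?W \<union> idx ` ?W \<union> ?D \<Longrightarrow> x < h'"
      using finite_nat_set_iff_bounded by meson
    obtain n x where x: "spaced c h' ?k x" "\<And>i. i < ?k \<Longrightarrow> x i \<in> fst (L ! i) \<inter> G n"
      using GF unfolding F_def by blast
    have new: "q (x i) \<notin> P \<union> N" if "i < ?k" for i
    proof
      assume "q (x i) \<in> P \<union> N"
      then have "x i < h'" "idx (x i) < h'" using h' by auto
      then show False using x(1) that unfolding spaced_def by force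
    qed
    \<comment> \<open>Points with equal image lie in one piece. In a spaced tuple two such points
      must have index at most \<open>c\<close>, and there \<open>h'\<close> excludes shared
      fibres.\<close>
    have inj: "q (x i) \<noteq> q (x j)" if "i < ?k" "j < ?k" "i \<noteq> j" for i j
    proof
      assume eq: "q (x i) = q (x j)"
      then have "idx (x i) = idx (x j)" by (rule q_idx)
      moreover have "x i \<noteq> x j" using x(1) that unfolding spaced_def inj_on_def by blast
      ultimately have "idx (x i) \<le> c" "h' \<le> x i" using x(1) that unfolding spaced_def by metis+
      moreover have "x i \<in> ?D" using eq \<open>x i \<noteq> x j\<close> \<open>idx (x i) \<le> c\<close> by force
      ultimately show False using h'[of "x i"] by auto
    qed
    let ?P = "P \<union> (\<lambda>i. q (x i)) ` {i. i < ?k \<and> snd (L ! i)}"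
    let ?N = "N \<union> (\<lambda>i. q (x i)) ` {i. i < ?k \<and> \<not> snd (L ! i)}"
    have "?P \<inter> ?N = {}" using new inj that(4) by auto
    moreover have "fm (G, L, c, h) V" if V: "?P \<subseteq> V" "V \<inter> ?N = {}" for V
    proof -
      have "spaced c h ?k x" using spaced_mono[OF x(1)] h'[of h] by auto
      moreover have "x i \<in> q -` V \<longleftrightarrow> snd (L ! i)" if "i < ?k" for i
        using that V by auto
      ultimately show ?thesis using x(2) unfolding fm_def by auto
    qed
    ultimately show ?thesis using that(2,3)
      by (intro exI[of _ ?P] exI[of _ ?N] conjI allI impI) auto
  qed
  have dense: "\<exists>P' N'. finite P' \<and> finite N' \<and> P' \<inter> N' = {} \<and> P \<subseteq> P' \<and> N \<subseteq> N' \<and>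
          (\<forall>V. P' \<subseteq> V \<and> V \<inter> N' = {} \<longrightarrow> r V)"
    if r: "r \<in> R" and "finite P" "finite N" "P \<inter> N = {}" for r P N
  proof -
    consider A m h b where "r = pt (A, m, h, b)" "A \<in> \<A> - {{}}"
      | G L c h where "r = fm (G, L, c, h)" "(G, L, c, h) \<in> F"
      using r unfolding R_def Q_def by fast
    then show ?thesis
    proof cases
      case 1
      show ?thesis unfolding 1(1) by (rule dense_pt[OF 1(2) that(2-4)])
    next
      case 2
      show ?thesis unfolding 2(1) by (rule dense_fm[OF 2(2) that(2-4)])
    qed
  qed
  have "\<exists>V. P0 \<subseteq> V \<and> V \<inter> N0 = {} \<and> (\<forall>r\<in>R. r V)"
    by (rule generic_set[OF count fin dense])
  then obtain V where V: "P0 \<subseteq> V" "V \<inter> N0 = {}" "\<And>r. r \<in> R \<Longrightarrow> r V" by blast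
  have "admissible (adjoin (q -` V) \<A>, \<P>)"
  proof (rule admissible_adjoin[OF adm])
    fix A m h b assume "A \<in> \<A> - {{}}"
    then have "pt (A, m, h, b) \<in> R" unfolding R_def Q_def by blast
    then have "pt (A, m, h, b) V" by (rule V(3))
    then show "\<exists>x\<in>A. idx x = m \<and> h \<le> x \<and> (x \<in> q -` V \<longleftrightarrow> b)" unfolding pt_def by simp
  next
    fix G L c h
    assume "G \<in> \<P>" "L \<in> lists ((\<A> - {{}}) \<times> (UNIV :: bool set))"
      "\<And>h. \<exists>n x. spaced c h (length L) x \<and> (\<forall>i<length L. x i \<in> fst (L ! i) \<inter> G n)"
    then have "(G, L, c, h) \<in> F" unfolding F_def by simp
    then have "fm (G, L, c, h) \<in> R" unfolding R_def by blast
    then have "fm (G, L, c, h) V" by (rule V(3))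
    then show "\<exists>n x. spaced c h (length L) x \<and>
        (\<forall>i<length L. x i \<in> fst (L ! i) \<inter> G n \<and> (x i \<in> q -` V \<longleftrightarrow> snd (L ! i)))"
      unfolding fm_def by simp
  qed
  with V(1,2) that show thesis by blast
qed

subsection \<open>Separating points and selecting from decreasing sequences\<close>


text \<open>Collapse each \<open>F m\<close> to a point. No \<open>F m\<close> contains both
  \<open>x\<close> and \<open>y\<close>, so their images differ and a generic \<open>V\<close> can
  separate them. The preimage of \<open>V\<close> splits no \<open>F m\<close>.\<close>

lemma extend_separating:
  assumes adm: "admissible s"
    and F: "\<And>m. finite (F m)" "\<And>m. F m \<subseteq> idx -` {m}"
    and xy: "x \<noteq> y" "\<And>m. \<not> {x, y} \<subseteq> F m"
  shows "\<exists>s'\<ge>s. admissible s' \<and> (\<exists>U\<in>fst s'. x \<in> U \<and> y \<notin> U \<and> (\<forall>m. F m \<subseteq> U \<or> F m \<inter> U = {}))"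
proof -
  obtain \<A> \<P> where s: "s = (\<A>, \<P>)" by fastforce
  \<comment> \<open>Only \<open>F (idx z)\<close> can contain \<open>z\<close>. The minimum is just
    a representative, taken of a nonempty set only.\<close>
  define q where "q z = (if z \<in> F (idx z) then Min (F (idx z)) else z)" for z
  have q_in: "q z \<in> F (idx z)" if "z \<in> F (idx z)" for z
    using that F(1) Min_in unfolding q_def by auto
  have q_idx: "idx (q z) = idx z" for z
  proof (cases "z \<in> F (idx z)")
    case True
    then have "q z \<in> idx -` {idx z}" using q_in F(2) by blast
    then show ?thesis by simp
  qed (simp add: q_def)
  have q_F: "u \<in> F (idx u) \<and> v \<in> F (idx u)" if "q u = q v" "u \<noteq> v" for u v
  proof -
    note eq = that(1)
    have "idx u = idx v" using q_idx[of u] q_idx[of v] eq by simp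
    then show ?thesis
      using q_in[of u] q_in[of v] that by (cases "u \<in> F (idx u)"; cases "v \<in> F (idx v)") (simp_all add: q_def)
  qed
  have nontriv: "finite {u. idx u = m \<and> (\<exists>v. v \<noteq> u \<and> q v = q u)}" for m
  proof (rule finite_subset[OF subsetI F(1)[of m]])
    fix u assume "u \<in> {u. idx u = m \<and> (\<exists>v. v \<noteq> u \<and> q v = q u)}"
    then obtain v where v: "v \<noteq> u" "q v = q u" and "idx u = m" by blast
    then show "u \<in> F m" using q_F[OF v(2,1)] q_idx[of u] q_idx[of v] by simp
  qed
  have fib: "finite (q -` {z})" for z
  proof (rule finite_subset)
    show "q -` {z} \<subseteq> insert z (F (idx z))"
      using q_idx by (auto simp: q_def split: if_splits)
    show "finite (insert z (F (idx z)))" using F by simp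
  qed
  have "q x \<noteq> q y" using q_F[of x y] xy by blast
  obtain V where V: "{q x} \<subseteq> V" "V \<inter> {q y} = {}" "admissible (adjoin (q -` V) \<A>, \<P>)"
  proof (rule admissible_extend[of \<A> \<P> q "{q x}" "{q y}"])
    show "admissible (\<A>, \<P>)" using adm s by simp
    show "idx u = idx v" if "q u = q v" for u v using q_idx that by metis
  qed (use fib nontriv \<open>q x \<noteq> q y\<close> in auto)
  have "algebra UNIV \<A>" using adm s unfolding admissible_def by simp
  note adj = algebra_adjoin[OF this, of "q -` V"]
  have "F m \<subseteq> q -` V \<or> F m \<inter> q -` V = {}" for m
  proof -
    have "q z = Min (F m)" if "z \<in> F m" for z
    proof -
      have "idx z = m" using that F(2) by blast
      then show ?thesis using that unfolding q_def by simp
    qed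
    then show ?thesis by (cases "Min (F m) \<in> V") auto
  qed
  then show ?thesis
    using adj V s by (intro exI[of _ "(adjoin (q -` V) \<A>, \<P>)"]) (auto simp: less_eq_prod_def)
qed

text \<open>If both alternatives failed, some \<open>A \<inter> E n0\<close> would meet only
  finitely many pieces, each in a set that becomes finite along the sequence. At a common later
  stage \<open>M\<close>, the set \<open>A \<inter> E M\<close> would be finite.\<close>

lemma infinite_or_unbounded_idx:
  assumes dec: "\<And>n. E (Suc n) \<subseteq> E n" and inf: "\<And>n. infinite (A \<inter> E n)"
  shows "(\<exists>j. \<forall>n. infinite (A \<inter> E n \<inter> idx -` {j})) \<or> (\<forall>n h. \<exists>x\<in>A \<inter> E n. h \<le> idx x)"
proof (rule disjCI)
  assume "\<not> (\<forall>n h. \<exists>x\<in>A \<inter> E n. h \<le> idx x)"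
  then obtain n0 h where h: "\<And>x. x \<in> A \<Longrightarrow> x \<in> E n0 \<Longrightarrow> idx x < h"
    by (auto simp: not_le)
  have mono: "E n \<subseteq> E m" if "m \<le> n" for m n
    using lift_Suc_antimono_le[of E] dec that by blast
  show "\<exists>j. \<forall>n. infinite (A \<inter> E n \<inter> idx -` {j})"
  proof (rule ccontr)
    assume "\<not> ?thesis"
    then obtain N where N: "\<And>j. finite (A \<inter> E (N j) \<inter> idx -` {j})" by metis
    define M where "M = n0 + (\<Sum>j<h. N j)"
    have "A \<inter> E M \<subseteq> (\<Union>j<h. A \<inter> E (N j) \<inter> idx -` {j})"
    proof
      fix x assume x: "x \<in> A \<inter> E M"
      then have j: "idx x < h" using h mono[of n0 M] unfolding M_def by auto
      then have "N (idx x) \<le> (\<Sum>j<h. N j)" by (intro member_le_sum) auto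
      then have "E M \<subseteq> E (N (idx x))" by (intro mono) (auto simp: M_def)
      then show "x \<in> (\<Union>j<h. A \<inter> E (N j) \<inter> idx -` {j})" using x j by auto
    qed
    then have "finite (A \<inter> E M)" by (rule finite_subset) (use N in auto)
    then show False using inf by blast
  qed
qed

lemma spaced_transversal:
  fixes B :: "nat \<Rightarrow> nat set"
  assumes "\<forall>i<k. (\<exists>j\<le>c. infinite (B i \<inter> idx -` {j})) \<or> (\<forall>h. \<exists>x\<in>B i. h \<le> idx x)"
  shows "\<exists>x. spaced c h k x \<and> (\<forall>i<k. x i \<in> B i)"
proof -
  \<comment> \<open>The extra \<open>c < idx (x i)\<close> strengthens the induction: a point alone
    in its piece is not disturbed by later points from pieces of index at most
    \<open>c\<close>.\<close>
  have "\<exists>x. inj_on x {..<k} \<and> (\<forall>i<k. x i \<in> B i \<and>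
      (idx (x i) \<le> c \<and> h \<le> x i \<or> c < idx (x i) \<and> h \<le> idx (x i) \<and> (\<forall>j<k. j \<noteq> i \<longrightarrow> idx (x j) \<noteq> idx (x i))))"
    using assms
  proof (induction k)
    case 0
    show ?case by simp
  next
    case (Suc k)
    have prem: "\<forall>i<k. (\<exists>j\<le>c. infinite (B i \<inter> idx -` {j})) \<or> (\<forall>h. \<exists>x\<in>B i. h \<le> idx x)"
      using Suc.prems less_SucI by blast
    obtain x where x: "inj_on x {..<k}" "\<forall>i<k. x i \<in> B i \<and>
      (idx (x i) \<le> c \<and> h \<le> x i \<or> c < idx (x i) \<and> h \<le> idx (x i) \<and> (\<forall>j<k. j \<noteq> i \<longrightarrow> idx (x j) \<noteq> idx (x i)))"
      using Suc.IH[OF prem] by (elim exE conjE) (rule that)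
    obtain z where z: "z \<in> B k" "z \<notin> x ` {..<k}"
      "idx z \<le> c \<and> h \<le> z \<or> c < idx z \<and> h \<le> idx z \<and> (\<forall>j<k. idx (x j) \<noteq> idx z)"
    proof -
      consider j where "j \<le> c" "infinite (B k \<inter> idx -` {j})" | "\<And>h. \<exists>z\<in>B k. h \<le> idx z"
        using Suc.prems by blast
      then show thesis
      proof cases
        case 1
        have "finite ({..<h} \<union> x ` {..<k})" by simp
        then have "\<not> B k \<inter> idx -` {j} \<subseteq> {..<h} \<union> x ` {..<k}" using 1(2) finite_subset by blast
        then obtain z where "z \<in> B k \<inter> idx -` {j}" "z \<notin> {..<h} \<union> x ` {..<k}" by blast
        then show thesis using 1(1) by (intro that[of z]) auto
      next
        case 2
        obtain M where M: "\<And>m. m \<in> {c, h} \<union> (\<lambda>i. idx (x i)) ` {..<k} \<Longrightarrow> m < M"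
          using finite_nat_set_iff_bounded[of "{c, h} \<union> (\<lambda>i. idx (x i)) ` {..<k}"] by auto
        obtain z where z: "z \<in> B k" "M \<le> idx z" using 2 by blast
        have "c < idx z" "h \<le> idx z" using M[of c] M[of h] z by auto
        moreover have ne: "idx (x j) \<noteq> idx z" if "j < k" for j using M[of "idx (x j)"] z that by auto
        moreover have "z \<notin> x ` {..<k}" using ne by auto
        ultimately show thesis using z(1) that by blast
      qed
    qed
    have "inj_on (x(k := z)) {..<Suc k}"
      using x(1) z(2) by (auto simp: inj_on_def less_Suc_eq)
    moreover have "(x(k := z)) i \<in> B i \<and>
      (idx ((x(k := z)) i) \<le> c \<and> h \<le> (x(k := z)) i \<or>
       c < idx ((x(k := z)) i) \<and> h \<le> idx ((x(k := z)) i) \<and>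
       (\<forall>j<Suc k. j \<noteq> i \<longrightarrow> idx ((x(k := z)) j) \<noteq> idx ((x(k := z)) i)))" if "i < Suc k" for i
    proof (cases "i = k")
      case True
      then show ?thesis using z by (auto simp: less_Suc_eq)
    next
      case False
      then have "i < k" using that by simp
      then show ?thesis using x(2)[rule_format, OF \<open>i < k\<close>] z by (auto simp: less_Suc_eq)
    qed
    ultimately show ?case by blast
  qed
  then show ?thesis unfolding spaced_def by blast
qed

text \<open>The dichotomy for decreasing sequences yields, for each list \<open>L\<close>, a bound
  \<open>c\<close> valid for all \<open>n\<close>. So whichever \<open>n\<close> a pair of
  \<open>L\<close> and \<open>h\<close> receives in an enumeration, a suitable spaced tuple exists
  inside \<open>E n\<close>; it becomes \<open>G n\<close>.\<close>

lemma robust_selection: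
  assumes count: "countable \<A>"
    and dec: "\<And>n. E (Suc n) \<subseteq> E n"
    and inf: "\<And>A n. A \<in> \<A> - {{}} \<Longrightarrow> infinite (A \<inter> E n)"
  obtains G where "robust \<A> G" "\<And>n. finite (G n) \<and> G n \<subseteq> E n"
proof -
  let ?\<L> = "lists (\<A> - {{}})"
  have ex_c: "\<exists>c. \<forall>n h. \<exists>x. spaced c h (length L) x \<and> (\<forall>i<length L. x i \<in> L ! i \<inter> E n)" if L: "L \<in> ?\<L>" for L
  proof -
    have "(\<exists>j. \<forall>n. infinite (A \<inter> E n \<inter> idx -` {j})) \<or> (\<forall>n h. \<exists>x\<in>A \<inter> E n. h \<le> idx x)"
      if "A \<in> set L" for A
      using infinite_or_unbounded_idx[of E A] dec inf that L unfolding in_lists_conv_set by blast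
    then obtain j where j: "\<And>A. A \<in> set L \<Longrightarrow>
        (\<forall>n. infinite (A \<inter> E n \<inter> idx -` {j A})) \<or> (\<forall>n h. \<exists>x\<in>A \<inter> E n. h \<le> idx x)"
      by metis
    \<comment> \<open>The sum is merely a common upper bound of the finitely many indices
      \<open>j A\<close>.\<close>
    define c where "c = (\<Sum>A\<in>set L. j A)"
    have c: "j A \<le> c" if "A \<in> set L" for A
      unfolding c_def using that by (intro member_le_sum) auto
    have "\<exists>x. spaced c h (length L) x \<and> (\<forall>i<length L. x i \<in> L ! i \<inter> E n)" for n h
    proof (rule spaced_transversal, intro allI impI)
      fix i assume "i < length L"
      then have "L ! i \<in> set L" by simp
      then show "(\<exists>j\<le>c. infinite (L ! i \<inter> E n \<inter> idx -` {j})) \<or> (\<forall>h. \<exists>x\<in>L ! i \<inter> E n. h \<le> idx x)"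
        using j c by blast
    qed
    then show ?thesis by blast
  qed
  then obtain c where c: "\<And>L n h. L \<in> ?\<L> \<Longrightarrow> \<exists>x. spaced (c L) h (length L) x \<and> (\<forall>i<length L. x i \<in> L ! i \<inter> E n)"
    by metis
  define x where "x L n h = (SOME x. spaced (c L) h (length L) x \<and> (\<forall>i<length L. x i \<in> L ! i \<inter> E n))" for L n h
  have x: "spaced (c L) h (length L) (x L n h)" "\<forall>i<length L. x L n h i \<in> L ! i \<inter> E n" if "L \<in> ?\<L>" for L n h
    using someI_ex[OF c[OF that]] unfolding x_def by blast+
  let ?I = "?\<L> \<times> (UNIV :: nat set)"
  have "countable ?I" "?I \<noteq> {}" using count by auto
  then have range: "range (from_nat_into ?I) = ?I" by (intro range_from_nat_into)
  define G where "G n = (case from_nat_into ?I n of (L, h) \<Rightarrow> x L n h ` {..<length L})" for n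
  have "finite (G n) \<and> G n \<subseteq> E n" for n
  proof -
    obtain L h where Lh: "from_nat_into ?I n = (L, h)" by fastforce
    moreover have "(L, h) \<in> ?I" using range Lh by (metis rangeI)
    ultimately show ?thesis using x(2) unfolding G_def by auto
  qed
  moreover have "robust \<A> G"
    unfolding robust_def
  proof
    fix L assume L: "L \<in> ?\<L>"
    have "\<exists>n x. spaced (c L) h (length L) x \<and> (\<forall>i<length L. x i \<in> L ! i \<inter> G n)" for h
    proof -
      have "(L, h) \<in> range (from_nat_into ?I)" using L range by blast
      then obtain n where n: "from_nat_into ?I n = (L, h)" by (metis rangeE)
      then have "G n = x L n h ` {..<length L}" unfolding G_def by simp
      then show ?thesis using x[OF L] by (intro exI[of _ n] exI[of _ "x L n h"]) auto
    qed
    then show "\<exists>c. \<forall>h. \<exists>n x. spaced c h (length L) x \<and> (\<forall>i<length L. x i \<in> L ! i \<inter> G n)" by blast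
  qed
  ultimately show thesis using that by blast
qed

text \<open>If some \<open>A \<inter> E n\<close> is finite, a generic set containing a point of
  \<open>A\<close> but missing \<open>A \<inter> E n\<close> makes \<open>E n\<close> non-dense.
  Otherwise a robust selection exists and is recorded for all later stages.\<close>

lemma extend_deciding:
  assumes adm: "admissible s" and dec: "\<And>n. E (Suc n) \<subseteq> E n"
  shows "\<exists>s'\<ge>s. admissible s' \<and>
    ((\<exists>n. \<exists>A\<in>fst s' - {{}}. A \<inter> E n = {}) \<or> (\<exists>G\<in>snd s'. \<forall>n. finite (G n) \<and> G n \<subseteq> E n))"
proof -
  obtain \<A> \<P> where s: "s = (\<A>, \<P>)" by fastforce
  have adm': "countable \<A>" "algebra UNIV \<A>" "spread \<A>"
    using adm s unfolding admissible_def by auto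
  show ?thesis
  proof (cases "\<exists>A\<in>\<A> - {{}}. \<exists>n. finite (A \<inter> E n)")
    case True
    then obtain A n where A: "A \<in> \<A> - {{}}" "finite (A \<inter> E n)" by blast
    have "infinite (A \<inter> idx -` {0})" using adm'(3) A(1) unfolding spread_def by blast
    then have "\<not> A \<inter> idx -` {0} \<subseteq> A \<inter> E n" using A(2) finite_subset by blast
    then obtain a where a: "a \<in> A" "a \<notin> E n" by blast
    \<comment> \<open>With the identity as \<open>q\<close> nothing is collapsed, and
      \<open>V\<close> is itself the adjoined set.\<close>
    obtain V where V: "{a} \<subseteq> V" "V \<inter> (A \<inter> E n) = {}" "admissible (adjoin ((\<lambda>x. x) -` V) \<A>, \<P>)"
    proof (rule admissible_extend[of \<A> \<P> "\<lambda>x. x" "{a}" "A \<inter> E n"])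
      show "admissible (\<A>, \<P>)" using adm s by simp
      show "finite ((\<lambda>x. x) -` {z})" for z :: nat by simp
    qed (use A a in auto)
    have V': "admissible (adjoin V \<A>, \<P>)" using V(3) by simp
    note adj = algebra_adjoin[OF adm'(2), of V]
    have "A \<in> adjoin V \<A>" using A(1) adj(2) by blast
    then have "A \<inter> V \<in> adjoin V \<A>" using adj(1,3) unfolding algebra_iff_Int by blast
    moreover have "A \<inter> V \<noteq> {}" "A \<inter> V \<inter> E n = {}" using a V by auto
    ultimately have "\<exists>n. \<exists>A\<in>adjoin V \<A> - {{}}. A \<inter> E n = {}" by blast
    moreover have "s \<le> (adjoin V \<A>, \<P>)" using adj(2) s by (simp add: less_eq_prod_def)
    ultimately show ?thesis
      using V' by (intro exI[of _ "(adjoin V \<A>, \<P>)"]) simp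
  next
    case False
    then have "infinite (A \<inter> E n)" if "A \<in> \<A> - {{}}" for A n using that by blast
    then obtain G where G: "robust \<A> G" "\<And>n. finite (G n) \<and> G n \<subseteq> E n"
      using robust_selection[of \<A> E] adm'(1) dec by metis
    have "admissible (\<A>, insert G \<P>)" using adm G(1) s by (simp add: admissible_def)
    moreover have "s \<le> (\<A>, insert G \<P>)" using s by (auto simp: less_eq_prod_def)
    ultimately show ?thesis
      using G(2) by (intro exI[of _ "(\<A>, insert G \<P>)"]) auto
  qed
qed

text \<open>Every condition concerns finitely many sets, which already lie in one stage of the
  chain. Countability of the chain is not assumed, so this covers the limit stages as well as the
  final union.\<close>

lemma admissible_chain_Union:
  assumes "C \<noteq> {}" and adm: "\<forall>s\<in>C. admissible s"
    and chain: "\<forall>s\<in>C. \<forall>t\<in>C. s \<le> t \<or> t \<le> s"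
  shows "algebra UNIV (\<Union>s\<in>C. fst s)" "spread (\<Union>s\<in>C. fst s)"
    "G \<in> (\<Union>s\<in>C. snd s) \<Longrightarrow> robust (\<Union>s\<in>C. fst s) G"
proof -
  have adm': "algebra UNIV (fst s)" "spread (fst s)" "G \<in> snd s \<Longrightarrow> robust (fst s) G" if "s \<in> C" for s G
    using adm that by (simp_all add: admissible_def)
  have up: "\<exists>u\<in>C. s \<le> u \<and> t \<le> u" if "s \<in> C" "t \<in> C" for s t
    using chain that by (metis order_refl)
  show "algebra UNIV (\<Union>s\<in>C. fst s)"
    unfolding algebra_iff_Int
  proof (intro conjI ballI)
    show "{} \<in> (\<Union>s\<in>C. fst s)" using assms(1) adm'(1) by (auto simp: algebra_iff_Int)
    fix A assume A: "A \<in> (\<Union>s\<in>C. fst s)"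
    then show "UNIV - A \<in> (\<Union>s\<in>C. fst s)" using adm'(1) unfolding algebra_iff_Int by blast
    fix B assume "B \<in> (\<Union>s\<in>C. fst s)"
    then obtain s t where st: "s \<in> C" "t \<in> C" "A \<in> fst s" "B \<in> fst t" using A by blast
    then obtain u where "u \<in> C" "A \<in> fst u" "B \<in> fst u"
      using up[of s t] unfolding less_eq_prod_def by blast
    then show "A \<inter> B \<in> (\<Union>s\<in>C. fst s)" using adm'(1)[of u] unfolding algebra_iff_Int by blast
  qed auto
  show "spread (\<Union>s\<in>C. fst s)"
    using adm'(2) unfolding spread_def by blast
  show "robust (\<Union>s\<in>C. fst s) G" if G: "G \<in> (\<Union>s\<in>C. snd s)"
    unfolding robust_def
  proof
    obtain s0 where s0: "s0 \<in> C" "G \<in> snd s0" using G by blast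
    fix L assume "L \<in> lists ((\<Union>s\<in>C. fst s) - {{}})"
    \<comment> \<open>A single stage has to contain all entries of \<open>L\<close> and also respect
      \<open>G\<close>, hence the stage is sought above \<open>s0\<close>.\<close>
    then have "\<exists>s\<in>C. s0 \<le> s \<and> L \<in> lists (fst s - {{}})"
    proof (induction L)
      case Nil
      then show ?case using \<open>s0 \<in> C\<close> by auto
    next
      case (Cons A L)
      then obtain s t where "s \<in> C" "s0 \<le> s" "L \<in> lists (fst s - {{}})" "t \<in> C" "A \<in> fst t - {{}}"
        by auto
      moreover from this obtain u where "u \<in> C" "s \<le> u" "t \<le> u" using up by blast
      moreover have "lists (fst s - {{}}) \<subseteq> lists (fst u - {{}})"
        using \<open>s \<le> u\<close> unfolding less_eq_prod_def by (intro lists_mono) blast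
      ultimately show ?case
        by (intro bexI[of _ u]) (auto simp: less_eq_prod_def)
    qed
    then obtain s where s: "s \<in> C" "s0 \<le> s" "L \<in> lists (fst s - {{}})" by blast
    then have "G \<in> snd s" using s0 unfolding less_eq_prod_def by blast
    then show "\<exists>c. \<forall>h. \<exists>n x. spaced c h (length L) x \<and> (\<forall>i<length L. x i \<in> L ! i \<inter> G n)"
      using adm'(3)[OF s(1)] s(3) unfolding robust_def by blast
  qed
qed

lemma admissible_Sup:
  assumes "countable C" "C \<noteq> {}" and adm: "\<forall>s\<in>C. admissible s"
    and chain: "\<forall>s\<in>C. \<forall>t\<in>C. s \<le> t \<or> t \<le> s"
  shows "admissible (Sup C)"
proof -
  have "countable (\<Union>s\<in>C. fst s)" "countable (\<Union>s\<in>C. snd s)"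
    using assms(1) adm by (auto simp: admissible_def)
  then show ?thesis
    using admissible_chain_Union[OF assms(2-4)]
    by (simp add: admissible_def Sup_prod_def)
qed

subsection \<open>The space\<close>


text \<open>One sequence codes both kinds of tasks; as a separation task it lists a pair of points
  to be separated, followed by the sets that may not be split.\<close>

definition meets_task :: "(nat \<Rightarrow> nat set) \<Rightarrow> nat set set \<times> (nat \<Rightarrow> nat set) set \<Rightarrow> bool" where
  "meets_task E s \<longleftrightarrow>
     ((\<exists>x\<in>E 0. \<exists>y\<in>E 0. x \<noteq> y \<and> (\<forall>m. \<not> {x, y} \<subseteq> E (Suc m))) \<and>
      (\<forall>m. finite (E (Suc m)) \<and> E (Suc m) \<subseteq> idx -` {m}) \<longrightarrow>
        (\<exists>U\<in>fst s. E 0 \<inter> U \<noteq> {} \<and> \<not> E 0 \<subseteq> U \<and> (\<forall>m. E (Suc m) \<subseteq> U \<or> E (Suc m) \<inter> U = {}))) \<and>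
     ((\<forall>n. E (Suc n) \<subseteq> E n) \<longrightarrow>
        (\<exists>n. \<exists>A\<in>fst s - {{}}. A \<inter> E n = {}) \<or> (\<exists>G\<in>snd s. \<forall>n. finite (G n) \<and> G n \<subseteq> E n))"

text \<open>The separation half persists when the algebra grows, so it is treated first and the
  deciding half second.\<close>

lemma extend_meets_task:
  assumes "admissible s"
  shows "\<exists>s'\<ge>s. admissible s' \<and> meets_task E s'"
proof -
  define sep where "sep s \<longleftrightarrow> ((\<exists>x\<in>E 0. \<exists>y\<in>E 0. x \<noteq> y \<and> (\<forall>m. \<not> {x, y} \<subseteq> E (Suc m))) \<and>
      (\<forall>m. finite (E (Suc m)) \<and> E (Suc m) \<subseteq> idx -` {m}) \<longrightarrow>
        (\<exists>U\<in>fst s. E 0 \<inter> U \<noteq> {} \<and> \<not> E 0 \<subseteq> U \<and> (\<forall>m. E (Suc m) \<subseteq> U \<or> E (Suc m) \<inter> U = {})))"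
    for s :: "nat set set \<times> (nat \<Rightarrow> nat set) set"
  define dcd where "dcd s \<longleftrightarrow> ((\<forall>n. E (Suc n) \<subseteq> E n) \<longrightarrow>
        (\<exists>n. \<exists>A\<in>fst s - {{}}. A \<inter> E n = {}) \<or> (\<exists>G\<in>snd s. \<forall>n. finite (G n) \<and> G n \<subseteq> E n))"
    for s :: "nat set set \<times> (nat \<Rightarrow> nat set) set"
  obtain s1 where s1: "s \<le> s1" "admissible s1" "sep s1"
  proof (cases "(\<exists>x\<in>E 0. \<exists>y\<in>E 0. x \<noteq> y \<and> (\<forall>m. \<not> {x, y} \<subseteq> E (Suc m))) \<and>
      (\<forall>m. finite (E (Suc m)) \<and> E (Suc m) \<subseteq> idx -` {m})")
    case True
    then obtain x y where xy: "x \<in> E 0" "y \<in> E 0" "x \<noteq> y" "\<And>m. \<not> {x, y} \<subseteq> E (Suc m)" by blast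
    obtain s1 U where "s \<le> s1" "admissible s1" and U: "U \<in> fst s1" "x \<in> U" "y \<notin> U"
        "\<forall>m. E (Suc m) \<subseteq> U \<or> E (Suc m) \<inter> U = {}"
      using extend_separating[OF assms, of "\<lambda>m. E (Suc m)" x y] True xy(3,4) by blast
    moreover have "E 0 \<inter> U \<noteq> {}" "\<not> E 0 \<subseteq> U" using U xy by auto
    then have "sep s1" unfolding sep_def using U(1,4) by blast
    ultimately show thesis using that by blast
  next
    case False
    then have "sep s" unfolding sep_def by blast
    then show thesis using assms that by blast
  qed
  obtain s2 where s2: "s1 \<le> s2" "admissible s2" "dcd s2"
  proof (cases "\<forall>n. E (Suc n) \<subseteq> E n")
    case True
    then obtain s2 where "s1 \<le> s2" "admissible s2"
      "(\<exists>n. \<exists>A\<in>fst s2 - {{}}. A \<inter> E n = {}) \<or> (\<exists>G\<in>snd s2. \<forall>n. finite (G n) \<and> G n \<subseteq> E n)"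
      using extend_deciding[OF s1(2), of E] by metis
    then show thesis using that unfolding dcd_def by metis
  next
    case False
    then have "dcd s1" unfolding dcd_def by blast
    then show thesis using that[of s1] s1(2) by simp
  qed
  have "fst s1 \<subseteq> fst s2" using s2(1) by (simp add: less_eq_prod_def)
  then have "sep s2" using s1(3) unfolding sep_def by (meson subsetD)
  then have "meets_task E s2" using s2(3) unfolding meets_task_def sep_def dcd_def by blast
  then show ?thesis using s1 s2 by (meson order_trans)
qed

text \<open>A set of naturals codes a sequence of such sets, so the chain indexed by
  \<open>nat set\<close> handles every task. Witnesses found at one stage stay in the union, and
  recorded selections are robust for the union.\<close>

lemma generic_algebra:
  assumes CH: continuum_hypothesis
  obtains \<A> where "algebra UNIV \<A>" "spread \<A>"
    "\<And>x y F. x \<noteq> y \<Longrightarrow> (\<And>m. \<not> {x, y} \<subseteq> F m) \<Longrightarrow> (\<And>m. finite (F m) \<and> F m \<subseteq> idx -` {m}) \<Longrightarrow>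
      \<exists>U\<in>\<A>. x \<in> U \<and> y \<notin> U \<and> (\<forall>m. F m \<subseteq> U \<or> F m \<inter> U = {})"
    "\<And>E. (\<And>n. E (Suc n) \<subseteq> E n) \<Longrightarrow>
      (\<exists>n. \<exists>A\<in>\<A> - {{}}. A \<inter> E n = {}) \<or> (\<exists>G. robust \<A> G \<and> (\<forall>n. finite (G n) \<and> G n \<subseteq> E n))"
proof -
  define dec where "dec t = (\<lambda>n :: nat. {x :: nat. prod_encode (n, x) \<in> t})" for t
  have dec: "\<exists>t. E = dec t" for E
    by (rule exI[of _ "{prod_encode (n, x) | n x. x \<in> E n}"]) (auto simp: dec_def)
  have "admissible ({{}, UNIV}, {})"
    by (auto simp: admissible_def algebra_iff_Int spread_def infinite_idx)
  from continuum_hypothesis_chain[OF CH, where N = admissible and T = "\<lambda>t. meets_task (dec t)",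
      OF this admissible_Sup extend_meets_task]
  obtain f where f: "\<And>t. admissible (f t)" "\<And>t. meets_task (dec t) (f t)"
      "\<And>t u. f t \<le> f u \<or> f u \<le> f t"
    by blast
  define \<A> where "\<A> = (\<Union>s\<in>range f. fst s)"
  have "range f \<noteq> {}" "\<forall>s\<in>range f. admissible s" "\<forall>s\<in>range f. \<forall>t\<in>range f. s \<le> t \<or> t \<le> s"
    using f by auto
  note \<A> = admissible_chain_Union[OF this, folded \<A>_def]
  have sub: "fst (f t) \<subseteq> \<A>" for t unfolding \<A>_def by auto
  show thesis
  proof (rule that[OF \<A>(1,2)])
    fix x y F
    assume *: "x \<noteq> y" "\<And>m. \<not> {x, y} \<subseteq> F m" "\<And>m. finite (F m) \<and> F m \<subseteq> idx -` {m}"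
    obtain t where t: "case_nat {x, y} F = dec t" using dec by blast
    have E: "dec t 0 = {x, y}" "dec t (Suc m) = F m" for m
      using t by (metis nat.case(1), metis nat.case(2))
    have "\<exists>U\<in>fst (f t). {x, y} \<inter> U \<noteq> {} \<and> \<not> {x, y} \<subseteq> U \<and> (\<forall>m. F m \<subseteq> U \<or> F m \<inter> U = {})"
      using f(2)[of t, unfolded meets_task_def, THEN conjunct1] * unfolding E by blast
    then obtain U where U: "U \<in> \<A>" "{x, y} \<inter> U \<noteq> {}" "\<not> {x, y} \<subseteq> U" "\<forall>m. F m \<subseteq> U \<or> F m \<inter> U = {}"
      using sub by blast
    \<comment> \<open>The task does not say which of the two points lies in \<open>U\<close>. The
      requirement on \<open>F\<close> is symmetric under complement, so the complement serves in the
      other case.\<close>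
    have U': "UNIV - U \<in> \<A>" "\<forall>m. F m \<subseteq> UNIV - U \<or> F m \<inter> (UNIV - U) = {}"
      using U(1,4) \<A>(1) unfolding algebra_iff_Int by blast+
    show "\<exists>U\<in>\<A>. x \<in> U \<and> y \<notin> U \<and> (\<forall>m. F m \<subseteq> U \<or> F m \<inter> U = {})"
    proof (cases "x \<in> U")
      case True
      then show ?thesis using U by (intro bexI[of _ U]) auto
    next
      case False
      then show ?thesis using U U' by (intro bexI[of _ "UNIV - U"] conjI) auto
    qed
  next
    fix E :: "nat \<Rightarrow> nat set" assume "\<And>n. E (Suc n) \<subseteq> E n"
    moreover obtain t where "E = dec t" using dec by blast
    ultimately have "(\<exists>n. \<exists>A\<in>fst (f t) - {{}}. A \<inter> E n = {}) \<or> (\<exists>G\<in>snd (f t). \<forall>n. finite (G n) \<and> G n \<subseteq> E n)"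
      using f(2)[of t] unfolding meets_task_def by blast
    moreover have "robust \<A> G" if "G \<in> snd (f t)" for G using \<A>(3) that by blast
    ultimately show "(\<exists>n. \<exists>A\<in>\<A> - {{}}. A \<inter> E n = {}) \<or> (\<exists>G. robust \<A> G \<and> (\<forall>n. finite (G n) \<and> G n \<subseteq> E n))"
      using sub by blast
  qed
qed

theorem theorem1p3:
  assumes CH: continuum_hypothesis
  shows "\<exists>X :: nat topology.
           countable (topspace X) \<and> regular_space X \<and> t1_space X \<and>
           without_isolated_points X \<and> mS_separable X \<and> \<not> S_separable X"
proof -
  obtain \<A> where alg: "algebra UNIV \<A>" and spr: "spread \<A>"
    and sep: "\<And>x y F. x \<noteq> y \<Longrightarrow> (\<And>m. \<not> {x, y} \<subseteq> F m) \<Longrightarrow> (\<And>m. finite (F m) \<and> F m \<subseteq> idx -` {m}) \<Longrightarrow>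
      \<exists>U\<in>\<A>. x \<in> U \<and> y \<notin> U \<and> (\<forall>m. F m \<subseteq> U \<or> F m \<inter> U = {})"
    and sel: "\<And>E. (\<And>n. E (Suc n) \<subseteq> E n) \<Longrightarrow>
      (\<exists>n. \<exists>A\<in>\<A> - {{}}. A \<inter> E n = {}) \<or> (\<exists>G. robust \<A> G \<and> (\<forall>n. finite (G n) \<and> G n \<subseteq> E n))"
    using generic_algebra[OF CH] by metis
  have Int: "A \<inter> B \<in> \<A>" if "A \<in> \<A>" "B \<in> \<A>" for A B
    using alg that unfolding algebra_iff_Int by blast
  have Compl: "- A \<in> \<A>" if "A \<in> \<A>" for A
    using alg that unfolding algebra_iff_Int by (simp add: Compl_eq_Diff_UNIV)
  have UNIV: "UNIV \<in> \<A>" using algebra.top[OF alg] .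
  \<comment> \<open>Members of the algebra are clopen, so the space is zero-dimensional, which
    yields regularity.\<close>
  define X where "X = topology (arbitrary union_of (\<lambda>A. A \<in> \<A>))"
  have basis: "openin X = arbitrary union_of (\<lambda>A. A \<in> \<A>)"
    unfolding X_def by (intro topology_inverse' istopology_base Int)
  have op: "openin X A" if "A \<in> \<A>" for A
    using that basis unfolding openin_topology_base_unique by blast
  have base: "\<exists>A\<in>\<A>. x \<in> A \<and> A \<subseteq> U" if "openin X U" "x \<in> U" for U x
    using that basis unfolding openin_topology_base_unique by blast
  have top: "topspace X = UNIV" using op[OF UNIV] openin_subset by blast
  have dense_iff: "dense_subset_of X D \<longleftrightarrow> (\<forall>A\<in>\<A> - {{}}. A \<inter> D \<noteq> {})" for D
  proof -
    have "dense_subset_of X D \<longleftrightarrow> (\<forall>T. openin X T \<and> T \<noteq> {} \<longrightarrow> D \<inter> T \<noteq> {})"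
      unfolding dense_subset_of_def dense_intersects_open using top by simp
    also have "\<dots> \<longleftrightarrow> (\<forall>A\<in>\<A> - {{}}. A \<inter> D \<noteq> {})"
    proof
      assume *: "\<forall>A\<in>\<A> - {{}}. A \<inter> D \<noteq> {}"
      show "\<forall>T. openin X T \<and> T \<noteq> {} \<longrightarrow> D \<inter> T \<noteq> {}"
      proof (intro allI impI)
        fix T assume "openin X T \<and> T \<noteq> {}"
        then obtain A where "A \<in> \<A> - {{}}" "A \<subseteq> T" using base by blast
        then show "D \<inter> T \<noteq> {}" using * by blast
      qed
    qed (use op in blast)
    finally show ?thesis .
  qed
  have "regular_space X"
    unfolding regular_space_def
  proof (intro allI impI)
    fix C a assume "closedin X C \<and> a \<in> topspace X - C"
    then obtain A where A: "A \<in> \<A>" "a \<in> A" "A \<subseteq> topspace X - C"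
      using base[of "topspace X - C" a] unfolding closedin_def by blast
    then show "\<exists>U V. openin X U \<and> openin X V \<and> a \<in> U \<and> C \<subseteq> V \<and> disjnt U V"
      using op Compl by (intro exI[of _ A] exI[of _ "- A"]) (auto simp: disjnt_def)
  qed
  moreover have "t1_space X"
    unfolding t1_space_def
  proof (intro ballI impI)
    fix x y :: nat assume "x \<noteq> y"
    \<comment> \<open>Separation with all \<open>F m\<close> empty gives T1.\<close>
    then obtain U where "U \<in> \<A>" "x \<in> U" "y \<notin> U" using sep[of x y "\<lambda>_. {}"] by auto
    then show "\<exists>U. openin X U \<and> x \<in> U \<and> y \<notin> U" using op by blast
  qed
  moreover have "without_isolated_points X"
    unfolding without_isolated_points_def
  proof (intro ballI notI)
    fix x assume "openin X {x}"
    then obtain A where "A \<in> \<A>" "x \<in> A" "A \<subseteq> {x}" using base by blast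
    then have "{x} \<in> \<A> - {{}}" by (auto simp: subset_singleton_iff)
    then have "infinite ({x} \<inter> idx -` {0})" using spr unfolding spread_def by blast
    then show False by simp
  qed
  moreover have "mS_separable X"
    unfolding mS_separable_def
  proof (intro allI impI)
    fix E assume E: "(\<forall>n. dense_subset_of X (E n)) \<and> (\<forall>n. E (Suc n) \<subseteq> E n)"
    \<comment> \<open>Density of all \<open>E n\<close> rules out the first alternative of
      \<open>sel\<close>.\<close>
    then obtain G where G: "robust \<A> G" "\<forall>n. finite (G n) \<and> G n \<subseteq> E n"
      using sel[of E] unfolding dense_iff by blast
    show "has_S_selection X E"
      unfolding has_S_selection_def
    proof (intro exI[of _ G] conjI allI impI)
      fix k :: nat and U :: "nat \<Rightarrow> nat set"
      assume U: "\<forall>i<k. openin X (U i) \<and> U i \<noteq> {}"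
      have "\<forall>i. \<exists>A. i < k \<longrightarrow> A \<in> \<A> - {{}} \<and> A \<subseteq> U i" using U base by blast
      then obtain A where A: "\<And>i. i < k \<Longrightarrow> A i \<in> \<A> - {{}} \<and> A i \<subseteq> U i" by metis
      have "set (map A [0..<k]) \<subseteq> \<A> - {{}}"
        unfolding set_map set_upt by (rule image_subsetI) (use A in \<open>simp only: atLeastLessThan_iff\<close>)
      then have "map A [0..<k] \<in> lists (\<A> - {{}})"
        unfolding lists_eq_set by (rule CollectI)
      from bspec[OF G(1)[unfolded robust_def] this]
      obtain n x where "\<forall>i<length (map A [0..<k]). x i \<in> map A [0..<k] ! i \<inter> G n"
        by blast
      then have "x i \<in> A i \<inter> G n" if "i < k" for i using that by simp
      then have "U i \<inter> G n \<noteq> {}" if "i < k" for i using A that by blast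
      then show "\<exists>n. \<forall>i<k. U i \<inter> G n \<noteq> {}" by blast
    qed (use G(2) in auto)
  qed
  moreover have "\<not> S_separable X"
  proof
    assume "S_separable X"
    moreover have "dense_subset_of X (idx -` {m})" for m
      using spr unfolding dense_iff spread_def by (metis finite.emptyI)
    ultimately have "has_S_selection X (\<lambda>m. idx -` {m})"
      unfolding S_separable_def by simp
    then obtain F where F: "\<forall>m. finite (F m) \<and> F m \<subseteq> idx -` {m}"
      and hit: "\<forall>(k :: nat) U. (\<forall>i<k. openin X (U i) \<and> U i \<noteq> {}) \<longrightarrow> (\<exists>n. \<forall>i<k. U i \<inter> F n \<noteq> {})"
      unfolding has_S_selection_def by (elim exE conjE) (rule that)
    \<comment> \<open>Two points of different pieces are never both in one \<open>F m\<close>, so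
      \<open>sep\<close> applies to them. No \<open>F n\<close> then meets both members of the
      family formed by \<open>U\<close> and its complement.\<close>
    define x y where "x = prod_encode (0, 0)" and "y = prod_encode (1, 0)"
    have idx: "idx x = 0" "idx y = 1" by (simp_all add: x_def y_def idx_def)
    have idx_F: "idx z = m" if "z \<in> F m" for z m using F that by blast
    have "x \<noteq> y" using idx by auto
    moreover have "\<not> {x, y} \<subseteq> F m" for m using idx_F[of x m] idx_F[of y m] idx by auto
    ultimately obtain U where U: "U \<in> \<A>" "x \<in> U" "y \<notin> U" "\<forall>m. F m \<subseteq> U \<or> F m \<inter> U = {}"
      using sep[of x y F, OF _ _ F[rule_format]] by blast
    let ?V = "\<lambda>i :: nat. if i = 0 then U else - U"
    have "\<forall>i<2. openin X (?V i) \<and> ?V i \<noteq> {}"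
      using op Compl U(1-3) by auto
    then obtain n where n: "\<forall>i<2. ?V i \<inter> F n \<noteq> {}"
      using hit[THEN spec[of _ 2], THEN spec[of _ ?V], THEN mp] by blast
    have "U \<inter> F n \<noteq> {}" "- U \<inter> F n \<noteq> {}"
      using n[rule_format, of 0] n[rule_format, of 1] by simp_all
    then show False using U(4) by blast
  qed
  ultimately show ?thesis using top by (intro exI[of _ X]) simp
qed

end
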